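(* For $i=1,2$ let $$\min_{x_i\in\mathbb{R}^{n_i}}\ \tfrac12x_i^{\mathsf T}P_ix_i+(q_i+N_iu)^{\mathsf T}x_i\quad\text{s.t.}\quad A_ix_i+M_iu=b_i$$ be an open quadratic program with input $u\in\mathbb{R}^m$, $P_i$ symmetric, KKT matrix $K_i=\begin{bmatrix} P_i & A_i^{\mathsf T} \\ A_i & 0 \end{bmatrix}$, value function $V_i$, primal--dual behavior $\mathcal{B}_i^{\mathrm{pd}}$ and value behavior $\mathcal{B}_i^{\mathrm v}$. Let $\psi_1,\psi_2:\mathbb{R}^\ell\to\mathbb{R}_{>0}$ be measurable functions (factors), let $Z_{12}=\int_{\mathbb{R}^\ell}\psi_1(z)\psi_2(z)\,dz$, let $\mu$ be a probability density on $\mathbb{R}^\ell$ (a belief) with differential entropy $\mathrm{h}(\mu)=-\mathbb{E}_\mu[\log\mu]$, and let $$\mathcal{F}_i=\mathbb{E}_\mu[\log\mu-\log\psi_i]\ (i=1,2),\qquad\mathcal{F}_{12}=\mathbb{E}_\mu[\log\mu-\log(\psi_1\psi_2)].$$ Let $Z_1$ and $Z_2$ have orthonormal columns spanning $\ker A_1$ and $\ker A_2$, let $G\in\mathbb{R}^{n_1\times n_2}$ be the coupling matrix of the joint program $$\min_{x\in\mathbb{R}^{n_1},\,\xi\in\mathbb{R}^{n_2}}\ \tfrac12x^{\mathsf T}P_1x+(q_1+G\xi)^{\mathsf T}x+\tfrac12\xi^{\mathsf T}P_2\xi+q_2^{\mathsf T}\xi\quad\text{s.t.}\quad A_1x=b_1,\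 A_2\xi=b_2,$$ and let $$\widehat P_i=Z_i^{\mathsf T}P_iZ_i,\qquad\widehat L=Z_1^{\mathsf T}GZ_2,\qquad\widehat P_{12}=\begin{bmatrix} \widehat P_1 & \widehat L \\ \widehat L^{\mathsf T} & \widehat P_2 \end{bmatrix}.$$ Assume $P_i\succeq0$ and $K_i$ nonsingular for $i=1,2$, $Z_{12}$ positive and finite, and $\mathbb{E}_\mu[\,|\log\mu|+|\log\psi_1|+|\log\psi_2|\,]<\infty$. Then the following statements hold. (i) Adding constants $\kappa_1,\kappa_2\in\mathbb{R}$ to the objectives of the two programs leaves $\mathcal{B}_1^{\mathrm{pd}}$ and $\mathcal{B}_2^{\mathrm{pd}}$ unchanged and adds $\kappa_1+\kappa_2$ to the value of any program minimizing the sum of the two objectives over a fixed feasible set. (ii) The interconnection $$u_1=u_2,\qquad y=y_1+y_2,\qquad\phi=\phi_1+\phi_2$$ maps $(\mathcal{B}_1^{\mathrm v},\mathcal{B}_2^{\mathrm v})$ to the value behavior of $V_1+V_2$; that is, $$\{(u,y_1+y_2,\phi_1+\phi_2)\mid(u,y_i,\phi_i)\in\mathcal{B}_i^{\mathrm v},\ i=1,2\}=\{(u,\nabla(V_1+V_2)(u),(V_1+V_2)(u))\mid u\in\mathbb{R}^m\}.$$ (iii) If $\widehat P_{12}\succ0$, then $$\log\det\widehat P_{12}=\log\det\widehat P_1+\log\det\big(\widehat P_2-\widehat L^{\mathsf T}\widehat P_1^{-1}\widehat L\big).$$ (iv) $\mathcal{F}_1+\mathcal{F}_2=\mathcal{F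}_{12}-\mathrm{h}(\mu)$.
   Context: For an open quadratic program $\min_x\{\tfrac12x^{\mathsf T}Px+(q+Nu)^{\mathsf T}x : Ax+Mu=b\}$ with input $u\in\mathbb{R}^m$, $P\succeq0$ and nonsingular KKT matrix $K=\begin{bmatrix} P & A^{\mathsf T} \\ A & 0 \end{bmatrix}$, the value function $V(u)$ is the optimal value; it is a polynomial of degree at most two in $u$. Let $(x^\star(u),\lambda^\star(u))$ be the unique solution of $K(x,\lambda)=(-(q+Nu),\,b-Mu)$. The primal--dual behavior is $\mathcal{B}^{\mathrm{pd}}=\{(u,y)\in\mathbb{R}^m\times\mathbb{R}^m\mid y=N^{\mathsf T}x^\star(u)+M^{\mathsf T}\lambda^\star(u)\}$, which equals the graph of $\nabla V$. The value behavior of the program (or of the function $V$) is $$\mathcal{B}^{\mathrm v}=\{(u,y,\phi)\in\mathbb{R}^m\times\mathbb{R}^m\times\mathbb{R}\mid y=\nabla V(u),\ \phi=V(u)\}.$$ $\mathbb{E}_\mu$ denotes expectation under $\mu$. The value of a minimization program is the infimum of its objective over its feasible set. The matrix $\widehat P_{12}$ is the reduced Hessian of the joint program, that is, the Hessian of its objective restricted to the kernel of its constraint matrix $\operatorname{diag}(A_1,A_2)$. Determinants of void matrices are $1$. *)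

theory Defs
  imports
    "HOL-Analysis.Analysis"
    "Jordan_Normal_Form.Matrix_Kernel"
    "Jordan_Normal_Form.Gauss_Jordan_Elimination"
begin

text \<open>
  Vectors and matrices have dimensions given by natural numbers, because kernels and constraint
  systems may have dimension 0 (the determinant of a 0-by-0 matrix is 1). HOL-Analysis also
  declares \<open>\<bullet>\<close>, \<open>vec\<close> and \<open>det\<close>: here \<open>\<bullet>\<close> is the scalar product of the
  dimension-indexed vectors.
\<close>

no_notation inner (infix \<open>\<bullet>\<close> 70)

type_synonym rvec = "real Matrix.vec"
type_synonym rmat = "real Matrix.mat"


subsection \<open>Definiteness, gradients, values of minimization programs\<close>

definition pos_semidef :: "nat \<Rightarrow> rmat \<Rightarrow> bool" where
  "pos_semidef n H \<longleftrightarrow> H \<in> carrier_mat n n \<and> transpose_mat H = H \<and>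
     (\<forall>v \<in> carrier_vec n. 0 \<le> v \<bullet> (H *\<^sub>v v))"

definition pos_def :: "nat \<Rightarrow> rmat \<Rightarrow> bool" where
  "pos_def n H \<longleftrightarrow> H \<in> carrier_mat n n \<and> transpose_mat H = H \<and>
     (\<forall>v \<in> carrier_vec n. v \<noteq> 0\<^sub>v n \<longrightarrow> 0 < v \<bullet> (H *\<^sub>v v))"

definition euclid_norm :: "rvec \<Rightarrow> real" where
  "euclid_norm v = sqrt (v \<bullet> v)"

text \<open>The type of vectors carries no topology, so Frechet differentiability of a function on
  \<^term>\<open>carrier_vec m\<close> at \<open>u\<close>, with gradient \<open>g\<close>, is written out:
  \<open>f (u + h) = f u + g \<bullet> h + o(\<parallel>h\<parallel>)\<close>.\<close>

definition has_gradient :: "nat \<Rightarrow> (rvec \<Rightarrow> real) \<Rightarrow> rvec \<Rightarrow> rvec \<Rightarrow> bool" where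
  "has_gradient m f u g \<longleftrightarrow> u \<in> carrier_vec m \<and> g \<in> carrier_vec m \<and>
     (\<forall>e>0. \<exists>d>0. \<forall>h \<in> carrier_vec m. euclid_norm h < d \<longrightarrow>
        \<bar>f (u + h) - f u - g \<bullet> h\<bar> \<le> e * euclid_norm h)"

definition gradient :: "nat \<Rightarrow> (rvec \<Rightarrow> real) \<Rightarrow> rvec \<Rightarrow> rvec" where
  "gradient m f u = (THE g. has_gradient m f u g)"

definition program_value :: "('a \<Rightarrow> real) \<Rightarrow> 'a set \<Rightarrow> ereal" where
  "program_value f S = (INF x \<in> S. ereal (f x))"


subsection \<open>Open quadratic programs\<close>

text \<open>The program with input \<open>u\<close> that minimizes \<open>x\<^sup>T P x / 2 + (q + N u)\<^sup>T x + c\<close>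
  subject to \<open>A x + M u = b\<close>. The constant \<open>c\<close> is there because constants added to the objective
  have to be represented; it is 0 for the programs one starts from.\<close>

record open_qp =
  qp_P :: rmat
  qp_q :: rvec
  qp_N :: rmat
  qp_A :: rmat
  qp_M :: rmat
  qp_b :: rvec
  qp_const :: real

definition is_open_qp :: "nat \<Rightarrow> nat \<Rightarrow> nat \<Rightarrow> open_qp \<Rightarrow> bool" where
  "is_open_qp m n p Q \<longleftrightarrow>
     qp_P Q \<in> carrier_mat n n \<and> transpose_mat (qp_P Q) = qp_P Q \<and>
     qp_q Q \<in> carrier_vec n \<and> qp_N Q \<in> carrier_mat n m \<and>
     qp_A Q \<in> carrier_mat p n \<and> qp_M Q \<in> carrier_mat p m \<and> qp_b Q \<in> carrier_vec p"

definition qp_objective :: "open_qp \<Rightarrow> rvec \<Rightarrow> rvec \<Rightarrow> real" where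
  "qp_objective Q u x =
     1/2 * (x \<bullet> (qp_P Q *\<^sub>v x)) + (qp_q Q + qp_N Q *\<^sub>v u) \<bullet> x + qp_const Q"

definition qp_feasible :: "open_qp \<Rightarrow> rvec \<Rightarrow> rvec set" where
  "qp_feasible Q u =
     {x \<in> carrier_vec (dim_col (qp_A Q)). qp_A Q *\<^sub>v x + qp_M Q *\<^sub>v u = qp_b Q}"

definition add_const :: "real \<Rightarrow> open_qp \<Rightarrow> open_qp" where
  "add_const \<kappa> Q = Q\<lparr>qp_const := qp_const Q + \<kappa>\<rparr>"

text \<open>The infimum is taken in the extended reals; it is finite when \<open>P\<close> is positive
  semidefinite and the KKT matrix is nonsingular, so the conversion to a real loses nothing.\<close>

definition value_function :: "open_qp \<Rightarrow> rvec \<Rightarrow> real" where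
  "value_function Q u = real_of_ereal (program_value (qp_objective Q u) (qp_feasible Q u))"

definition kkt_matrix :: "open_qp \<Rightarrow> rmat" where
  "kkt_matrix Q = four_block_mat (qp_P Q) (transpose_mat (qp_A Q))
     (qp_A Q) (0\<^sub>m (dim_row (qp_A Q)) (dim_row (qp_A Q)))"

definition is_kkt_solution :: "open_qp \<Rightarrow> rvec \<Rightarrow> rvec \<times> rvec \<Rightarrow> bool" where
  "is_kkt_solution Q u = (\<lambda>(x, lam).
     x \<in> carrier_vec (dim_col (qp_A Q)) \<and> lam \<in> carrier_vec (dim_row (qp_A Q)) \<and>
     kkt_matrix Q *\<^sub>v (x @\<^sub>v lam) =
       (- (qp_q Q + qp_N Q *\<^sub>v u)) @\<^sub>v (qp_b Q - qp_M Q *\<^sub>v u))"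

definition kkt_solution :: "open_qp \<Rightarrow> rvec \<Rightarrow> rvec \<times> rvec" where
  "kkt_solution Q u = (THE xl. is_kkt_solution Q u xl)"

definition pd_behavior :: "nat \<Rightarrow> open_qp \<Rightarrow> (rvec \<times> rvec) set" where
  "pd_behavior m Q = {(u, y). u \<in> carrier_vec m \<and>
     y = transpose_mat (qp_N Q) *\<^sub>v fst (kkt_solution Q u)
       + transpose_mat (qp_M Q) *\<^sub>v snd (kkt_solution Q u)}"

text \<open>For positive semidefinite \<open>P\<close> and nonsingular KKT matrix the gradient graph of the value function
  is another description of \<open>pd_behavior\<close>, one whose definition involves the objective including its constant.\<close>

definition gradient_graph :: "nat \<Rightarrow> (rvec \<Rightarrow> real) \<Rightarrow> (rvec \<times> rvec) set" where
  "gradient_graph m V = {(u, y). has_gradient m V u y}"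

text \<open>Membership in the value behavior of \<open>V\<close> includes differentiability of \<open>V\<close> at \<open>u\<close>.\<close>

definition value_behavior :: "nat \<Rightarrow> (rvec \<Rightarrow> real) \<Rightarrow> (rvec \<times> rvec \<times> real) set" where
  "value_behavior m V = {(u, y, \<phi>). has_gradient m V u y \<and> \<phi> = V u}"

definition interconnection ::
    "(rvec \<times> rvec \<times> real) set \<Rightarrow> (rvec \<times> rvec \<times> real) set \<Rightarrow> (rvec \<times> rvec \<times> real) set" where
  "interconnection B1 B2 = {(u, y, \<phi>). \<exists>u1 y1 \<phi>1 u2 y2 \<phi>2.
     (u1, y1, \<phi>1) \<in> B1 \<and> (u2, y2, \<phi>2) \<in> B2 \<and>
     u1 = u2 \<and> u = u1 \<and> y = y1 + y2 \<and> \<phi> = \<phi>1 + \<phi>2}"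


subsection \<open>Reduced Hessians\<close>

definition orthonormal_kernel_basis :: "nat \<Rightarrow> nat \<Rightarrow> rmat \<Rightarrow> rmat \<Rightarrow> bool" where
  "orthonormal_kernel_basis n d A Z \<longleftrightarrow> Z \<in> carrier_mat n d \<and>
     (\<forall>i<d. \<forall>j<d. col Z i \<bullet> col Z j = (if i = j then 1 else 0)) \<and>
     vec_space.col_space n Z = mat_kernel A"

text \<open>The library inverse is an option, \<open>None\<close> for singular matrices.\<close>

definition inv_mat :: "rmat \<Rightarrow> rmat" where
  "inv_mat H = the (mat_inverse H)"


subsection \<open>Beliefs\<close>

definition is_density :: "(real^'l \<Rightarrow> real) \<Rightarrow> bool" where
  "is_density \<mu> \<longleftrightarrow> \<mu> \<in> borel_measurable lebesgue \<and> (\<forall>z. 0 \<le> \<mu> z) \<and>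
     (\<integral>\<^sup>+ z. ennreal (\<mu> z) \<partial>lebesgue) = 1"

definition belief_measure :: "(real^'l \<Rightarrow> real) \<Rightarrow> (real^'l) measure" where
  "belief_measure \<mu> = density lebesgue (\<lambda>z. ennreal (\<mu> z))"

definition belief_expectation :: "(real^'l \<Rightarrow> real) \<Rightarrow> (real^'l \<Rightarrow> real) \<Rightarrow> real" where
  "belief_expectation \<mu> f = (\<integral>z. f z \<partial>belief_measure \<mu>)"

text \<open>The value of \<open>ln (\<mu> z)\<close> where \<open>\<mu> z = 0\<close> is irrelevant: these points form a null set of
  \<^term>\<open>belief_measure \<mu>\<close>.\<close>

definition differential_entropy :: "(real^'l \<Rightarrow> real) \<Rightarrow> real" where
  "differential_entropy \<mu> = - belief_expectation \<mu> (\<lambda>z. ln (\<mu> z))"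

definition free_energy :: "(real^'l \<Rightarrow> real) \<Rightarrow> (real^'l \<Rightarrow> real) \<Rightarrow> real" where
  "free_energy \<mu> \<psi> = belief_expectation \<mu> (\<lambda>z. ln (\<mu> z) - ln (\<psi> z))"

end

theory Submission
  imports Defs "Jordan_Normal_Form.Char_Poly"
begin

text \<open>
  Perturbing a KKT point \<open>(x, \<lambda>)\<close> at \<open>u\<close> by \<open>d\<close> while the input moves to \<open>u + h\<close> changes the
  objective by \<open>(N\<^sup>T x) \<bullet> h - \<lambda> \<bullet> (A d)\<close> plus the terms \<open>(N h) \<bullet> d + d \<bullet> (P d) / 2\<close>. With \<open>h = 0\<close> and
  \<open>A d = 0\<close> this shows that \<open>x\<close> is optimal, since \<open>P\<close> is positive semidefinite. With \<open>d\<close> the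
  displacement of the KKT point, \<open>A d = - M h\<close> and \<open>d\<close> is linear in \<open>h\<close>, so the gradient of the value
  function is \<open>N\<^sup>T x + M\<^sup>T \<lambda>\<close> with a remainder quadratic in \<open>h\<close>; this is not affected by constants.
  The identity for the log-determinants is block elimination, where the determinants are positive
  because the characteristic polynomial of \<open>- H\<close> has no nonnegative root for positive definite \<open>H\<close>.
\<close>

subsection \<open>Gradients\<close>

lemma scalar_prod_self_nonneg: "0 \<le> v \<bullet> (v :: rvec)"
  by (auto simp: scalar_prod_def intro!: sum_nonneg)

lemma scalar_prod_self_pos:
  fixes v :: rvec
  assumes "v \<in> carrier_vec n" "v \<noteq> 0\<^sub>v n"
  shows "0 < v \<bullet> v"
proof -
  obtain i where i: "i < n" "v $ i \<noteq> 0"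
    using assms by (metis carrier_vecD eq_vecI index_zero_vec)
  have "0 < v $ i * v $ i" using i not_real_square_gt_zero by blast
  also have "\<dots> \<le> (\<Sum>j\<in>{0..<n}. v $ j * v $ j)"
    using i by (intro member_le_sum) auto
  finally show ?thesis using assms by (simp add: scalar_prod_def)
qed

lemma euclid_norm_nonneg: "0 \<le> euclid_norm v"
  by (simp add: euclid_norm_def scalar_prod_self_nonneg)

lemma euclid_norm_square: "euclid_norm v * euclid_norm v = v \<bullet> v"
  by (simp add: euclid_norm_def scalar_prod_self_nonneg)

lemma abs_index_le_euclid_norm:
  assumes "v \<in> carrier_vec n" "i < n"
  shows "\<bar>v $ i\<bar> \<le> euclid_norm v"
proof -
  have "v $ i * v $ i \<le> (\<Sum>j\<in>{0..<n}. v $ j * v $ j)"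
    using assms by (intro member_le_sum) auto
  then have "(v $ i)\<^sup>2 \<le> v \<bullet> v"
    using assms by (simp add: scalar_prod_def power2_eq_square)
  then show ?thesis unfolding euclid_norm_def by (metis real_sqrt_abs real_sqrt_le_mono)
qed

lemma euclid_norm_smult: "euclid_norm (t \<cdot>\<^sub>v v) = \<bar>t\<bar> * euclid_norm v"
proof -
  have "(t \<cdot>\<^sub>v v) \<bullet> (t \<cdot>\<^sub>v v) = t\<^sup>2 * (v \<bullet> v)"
    by (simp add: scalar_prod_def sum_distrib_left power2_eq_square algebra_simps)
  then show ?thesis by (simp add: euclid_norm_def real_sqrt_mult)
qed

lemma has_gradient_add:
  assumes f: "has_gradient m f u g" and f': "has_gradient m f' u g'"
  shows "has_gradient m (\<lambda>v. f v + f' v) u (g + g')"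
  unfolding has_gradient_def
proof (intro conjI allI impI)
  show "u \<in> carrier_vec m" "g + g' \<in> carrier_vec m"
    using f f' by (auto simp: has_gradient_def)
  fix e :: real assume "e > 0"
  then have "e / 2 > 0" by simp
  then obtain d d' where d: "d > 0" "\<And>h. h \<in> carrier_vec m \<Longrightarrow> euclid_norm h < d \<Longrightarrow>
        \<bar>f (u + h) - f u - g \<bullet> h\<bar> \<le> e / 2 * euclid_norm h"
    and d': "d' > 0" "\<And>h. h \<in> carrier_vec m \<Longrightarrow> euclid_norm h < d' \<Longrightarrow>
        \<bar>f' (u + h) - f' u - g' \<bullet> h\<bar> \<le> e / 2 * euclid_norm h"
    using f f' unfolding has_gradient_def by metis
  show "\<exists>d>0. \<forall>h\<in>carrier_vec m. euclid_norm h < d \<longrightarrow>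
      \<bar>f (u + h) + f' (u + h) - (f u + f' u) - (g + g') \<bullet> h\<bar> \<le> e * euclid_norm h"
  proof (intro exI[of _ "min d d'"] conjI ballI impI)
    fix h :: rvec assume h: "h \<in> carrier_vec m" "euclid_norm h < min d d'"
    have "(g + g') \<bullet> h = g \<bullet> h + g' \<bullet> h"
      using f f' h by (intro add_scalar_prod_distrib[of _ m]) (auto simp: has_gradient_def)
    moreover have "\<bar>f (u + h) - f u - g \<bullet> h\<bar> \<le> e / 2 * euclid_norm h"
      "\<bar>f' (u + h) - f' u - g' \<bullet> h\<bar> \<le> e / 2 * euclid_norm h"
      using d(2) d'(2) h by auto
    ultimately show "\<bar>f (u + h) + f' (u + h) - (f u + f' u) - (g + g') \<bullet> h\<bar> \<le> e * euclid_norm h"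
      by linarith
  qed (use d d' in auto)
qed

text \<open>Two gradients differ by a linear functional that is
  \<open>o(\<parallel>h\<parallel>)\<close>. Testing it along its own representing vector
  \<open>w = g - g'\<close> forces \<open>w\<close> to vanish.\<close>

lemma has_gradient_unique:
  assumes g: "has_gradient m f u g" and g': "has_gradient m f u g'"
  shows "g = g'"
proof (rule ccontr)
  assume neq: "g \<noteq> g'"
  have c[simp]: "g \<in> carrier_vec m" "g' \<in> carrier_vec m" using g g' by (auto simp: has_gradient_def)
  define w where "w = g - g'"
  define r where "r = euclid_norm w"
  have w[simp]: "w \<in> carrier_vec m" by (simp add: w_def)
  have "w \<noteq> 0\<^sub>v m"
  proof
    assume "w = 0\<^sub>v m"
    have "g $ i = g' $ i" if "i < m" for i
    proof -
      have "w $ i = g $ i - g' $ i"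
        unfolding w_def by (rule index_minus_vec(1)) (metis that c(2) carrier_vecD)
      moreover have "w $ i = 0" using that \<open>w = 0\<^sub>v m\<close> by simp
      ultimately show ?thesis by simp
    qed
    then show False using neq c by (metis carrier_vecD eq_vecI)
  qed
  then have "0 < w \<bullet> w" by (rule scalar_prod_self_pos[OF w])
  then have r: "r > 0" by (simp add: r_def euclid_norm_def)
  \<comment> \<open>With tolerance \<open>r / 4\<close> in both expansions, the two linear terms at
    \<open>h = t w\<close> differ by at most half of \<open>t * (r * r)\<close>, whereas
    \<open>w \<bullet> h\<close> equals all of it.\<close>
  then have "r / 4 > 0" by simp
  then obtain d d' where d: "d > 0" "\<And>h. h \<in> carrier_vec m \<Longrightarrow> euclid_norm h < d \<Longrightarrow>
        \<bar>f (u + h) - f u - g \<bullet> h\<bar> \<le> r / 4 * euclid_norm h"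
    and d': "d' > 0" "\<And>h. h \<in> carrier_vec m \<Longrightarrow> euclid_norm h < d' \<Longrightarrow>
        \<bar>f (u + h) - f u - g' \<bullet> h\<bar> \<le> r / 4 * euclid_norm h"
    using g g' unfolding has_gradient_def by metis
  \<comment> \<open>This scaling gives the increment the norm \<open>min d d' / 2\<close>, strictly
    inside both radii.\<close>
  define t where "t = min d d' / (2 * r)"
  have t: "t > 0" using d d' r by (simp add: t_def)
  define h where "h = t \<cdot>\<^sub>v w"
  have h: "h \<in> carrier_vec m" by (simp add: h_def)
  have nh: "euclid_norm h = t * r" using t by (simp add: h_def euclid_norm_smult r_def)
  have "t * r = min d d' / 2" using r by (simp add: t_def)
  then have "euclid_norm h < d" "euclid_norm h < d'" using nh d(1) d'(1) by linarith+
  then have "\<bar>f (u + h) - f u - g \<bullet> h\<bar> \<le> r / 4 * (t * r)"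
    "\<bar>f (u + h) - f u - g' \<bullet> h\<bar> \<le> r / 4 * (t * r)"
    using d(2)[OF h] d'(2)[OF h] nh by auto
  then have "g \<bullet> h - g' \<bullet> h \<le> r / 2 * (t * r)" by linarith
  moreover have "g \<bullet> h - g' \<bullet> h = w \<bullet> h"
    using minus_scalar_prod_distrib[of g m g' h] h by (simp add: w_def)
  moreover have "w \<bullet> h = t * (r * r)"
    by (simp add: h_def r_def euclid_norm_square)
  ultimately have "t * (r * r) \<le> t * (r * r) / 2" by (simp add: algebra_simps)
  moreover have "0 < t * (r * r)" using t r by simp
  ultimately show False by linarith
qed

lemma gradient_eqI: "has_gradient m f u g \<Longrightarrow> gradient m f u = g"
  unfolding gradient_def by (blast intro: the_equality has_gradient_unique)

text \<open>One inclusion is the sum rule. The converse has to split a gradient of the sum, which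
  works because both summands are differentiable at every input: by uniqueness the given gradient is
  \<open>g1 u + g2 u\<close>.\<close>

lemma interconnection_value_behavior:
  assumes g1: "\<And>u. u \<in> carrier_vec m \<Longrightarrow> has_gradient m V1 u (g1 u)"
    and g2: "\<And>u. u \<in> carrier_vec m \<Longrightarrow> has_gradient m V2 u (g2 u)"
  shows "interconnection (value_behavior m V1) (value_behavior m V2)
      = value_behavior m (\<lambda>u. V1 u + V2 u)"
    and "value_behavior m (\<lambda>u. V1 u + V2 u)
      = {(u, gradient m (\<lambda>u. V1 u + V2 u) u, V1 u + V2 u) | u. u \<in> carrier_vec m}"
proof -
  let ?V = "\<lambda>u. V1 u + V2 u"
  have g: "has_gradient m ?V u (g1 u + g2 u)" if "u \<in> carrier_vec m" for u
    by (intro has_gradient_add g1 g2 that)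
  have carr: "u \<in> carrier_vec m" if "has_gradient m f u y" for f u y
    using that by (simp add: has_gradient_def)
  show "interconnection (value_behavior m V1) (value_behavior m V2) = value_behavior m ?V"
  proof (intro Set.set_eqI iffI)
    fix w assume "w \<in> interconnection (value_behavior m V1) (value_behavior m V2)"
    then show "w \<in> value_behavior m ?V"
      by (auto simp: interconnection_def value_behavior_def intro: has_gradient_add)
  next
    fix w assume "w \<in> value_behavior m ?V"
    then obtain u y where w: "w = (u, y, ?V u)" "has_gradient m ?V u y"
      by (auto simp: value_behavior_def)
    have u: "u \<in> carrier_vec m" using carr[OF w(2)] .
    have "y = g1 u + g2 u" by (rule has_gradient_unique[OF w(2) g[OF u]])
    then show "w \<in> interconnection (value_behavior m V1) (value_behavior m V2)"
      using g1[OF u] g2[OF u] w(1) unfolding interconnection_def value_behavior_def by blast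
  qed
  show "value_behavior m ?V = {(u, gradient m ?V u, ?V u) | u. u \<in> carrier_vec m}"
  proof (intro Set.set_eqI iffI)
    fix w assume "w \<in> value_behavior m ?V"
    then obtain u y where w: "w = (u, y, ?V u)" "has_gradient m ?V u y"
      by (auto simp: value_behavior_def)
    then show "w \<in> {(u, gradient m ?V u, ?V u) | u. u \<in> carrier_vec m}"
      using gradient_eqI[OF w(2)] carr[OF w(2)] by blast
  next
    fix w assume "w \<in> {(u, gradient m ?V u, ?V u) | u. u \<in> carrier_vec m}"
    then obtain u where u: "w = (u, gradient m ?V u, ?V u)" "u \<in> carrier_vec m" by blast
    then show "w \<in> value_behavior m ?V"
      using g[OF u(2)] gradient_eqI[OF g[OF u(2)]] by (simp add: value_behavior_def)
  qed
qed

subsection \<open>Value functions of open quadratic programs\<close>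

lemma mult_mat_vec_carrier_row:
  "A \<in> carrier_mat r c \<Longrightarrow> A *\<^sub>v v \<in> carrier_vec r"
  by (metis carrier_matD(1) carrier_vec_dim_vec dim_mult_mat_vec)

lemma mult_transpose_mat_vec_carrier:
  "A \<in> carrier_mat r c \<Longrightarrow> transpose_mat A *\<^sub>v v \<in> carrier_vec c"
  by (simp add: mult_mat_vec_carrier_row)

lemma is_open_qpD:
  assumes "is_open_qp m n p Q"
  shows "qp_P Q \<in> carrier_mat n n" "transpose_mat (qp_P Q) = qp_P Q"
    "qp_q Q \<in> carrier_vec n" "qp_N Q \<in> carrier_mat n m" "qp_A Q \<in> carrier_mat p n"
    "qp_M Q \<in> carrier_mat p m" "qp_b Q \<in> carrier_vec p"
    "dim_row (qp_A Q) = p" "dim_col (qp_A Q) = n"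
  using assms by (auto simp: is_open_qp_def)

text \<open>The two block rows of the KKT system are stationarity of the Lagrangian in
  \<open>x\<close> and primal feasibility. All later arguments use them in this separated
  form.\<close>

lemma is_kkt_solution_iff:
  assumes Q: "is_open_qp m n p Q" and u: "u \<in> carrier_vec m"
  shows "is_kkt_solution Q u (x, lam) \<longleftrightarrow> x \<in> carrier_vec n \<and> lam \<in> carrier_vec p \<and>
    qp_P Q *\<^sub>v x + transpose_mat (qp_A Q) *\<^sub>v lam = - (qp_q Q + qp_N Q *\<^sub>v u) \<and>
    qp_A Q *\<^sub>v x = qp_b Q - qp_M Q *\<^sub>v u"
proof (cases "x \<in> carrier_vec n \<and> lam \<in> carrier_vec p")
  case True
  note D = is_open_qpD[OF Q]
  have "kkt_matrix Q *\<^sub>v (x @\<^sub>v lam)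
      = (qp_P Q *\<^sub>v x + transpose_mat (qp_A Q) *\<^sub>v lam) @\<^sub>v (qp_A Q *\<^sub>v x + 0\<^sub>m p p *\<^sub>v lam)"
    unfolding kkt_matrix_def D(8) using True D by (intro four_block_mat_mult_vec) auto
  also have "0\<^sub>m p p *\<^sub>v lam = 0\<^sub>v p" using True by (intro eq_vecI) auto
  also have "qp_A Q *\<^sub>v x + 0\<^sub>v p = qp_A Q *\<^sub>v x" using True D by simp
  finally show ?thesis
    using True D u by (simp add: is_kkt_solution_def append_vec_eq[of _ n])
qed (use is_open_qpD[OF Q] in \<open>auto simp: is_kkt_solution_def\<close>)

text \<open>Expanding the quadratic leaves the first-order term
  \<open>(P x + q + N u) \<bullet> d\<close>, which stationarity turns into
  \<open>- lam \<bullet> (A d)\<close>. As \<open>h\<close> and \<open>d\<close> vary independently,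
  the same identity serves competitors at a fixed input and the displaced KKT point.\<close>

lemma qp_objective_perturb:
  assumes Q: "is_open_qp m n p Q"
    and sol: "is_kkt_solution Q u (x, lam)"
    and c: "u \<in> carrier_vec m" "h \<in> carrier_vec m" "d \<in> carrier_vec n"
  shows "qp_objective Q (u + h) (x + d) = qp_objective Q u x
    + (transpose_mat (qp_N Q) *\<^sub>v x) \<bullet> h - lam \<bullet> (qp_A Q *\<^sub>v d)
    + (qp_N Q *\<^sub>v h) \<bullet> d + 1/2 * (d \<bullet> (qp_P Q *\<^sub>v d))"
proof -
  note D = is_open_qpD[OF Q]
  note K = sol[unfolded is_kkt_solution_iff[OF Q c(1)]]
  have x[simp]: "x \<in> carrier_vec n" and lam[simp]: "lam \<in> carrier_vec p" using K by auto
  note [simp] = c D(1,3-7)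
  define s where "s = qp_q Q + qp_N Q *\<^sub>v u"
  have s[simp]: "s \<in> carrier_vec n"
    unfolding s_def by (intro add_carrier_vec D(3) mult_mat_vec_carrier_row[OF D(4)])
  have Px[simp]: "qp_P Q *\<^sub>v v \<in> carrier_vec n" "qp_N Q *\<^sub>v h \<in> carrier_vec n"
    "transpose_mat (qp_A Q) *\<^sub>v lam \<in> carrier_vec n"
    "transpose_mat (qp_N Q) *\<^sub>v x \<in> carrier_vec m" for v
    using D(1,4,5)[THEN mult_mat_vec_carrier_row]
      D(4,5)[THEN mult_transpose_mat_vec_carrier] by blast+
  \<comment> \<open>Symmetry of \<open>P\<close> makes both cross terms equal to
    \<open>(P x) \<bullet> d\<close>, which explains the factor 2 in \<open>quad\<close>.\<close>
  have sym: "v \<bullet> (qp_P Q *\<^sub>v w) = (qp_P Q *\<^sub>v v) \<bullet> w" if "v \<in> carrier_vec n" "w \<in> carrier_vec n" for v w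
    using transpose_vec_mult_scalar[OF D(1) that(2,1)] by (simp add: D(2))
  have xPd: "x \<bullet> (qp_P Q *\<^sub>v d) = (qp_P Q *\<^sub>v x) \<bullet> d" using sym[of x d] by simp
  have dPx: "d \<bullet> (qp_P Q *\<^sub>v x) = (qp_P Q *\<^sub>v x) \<bullet> d" by (rule comm_scalar_prod[of _ n]) auto
  have shift: "qp_q Q + qp_N Q *\<^sub>v (u + h) = s + qp_N Q *\<^sub>v h"
    unfolding s_def mult_add_distrib_mat_vec[OF D(4) c(1,2)]
    by (rule assoc_add_vec[symmetric, OF D(3)]; rule mult_mat_vec_carrier_row[OF D(4)])
  have quad: "(x + d) \<bullet> (qp_P Q *\<^sub>v (x + d))
      = x \<bullet> (qp_P Q *\<^sub>v x) + 2 * ((qp_P Q *\<^sub>v x) \<bullet> d) + d \<bullet> (qp_P Q *\<^sub>v d)"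
    by (simp add: mult_add_distrib_mat_vec[OF D(1)] add_scalar_prod_distrib[of _ n]
        scalar_prod_add_distrib[of _ n] xPd dPx)
  have lin: "(s + qp_N Q *\<^sub>v h) \<bullet> (x + d)
      = s \<bullet> x + s \<bullet> d + (qp_N Q *\<^sub>v h) \<bullet> x + (qp_N Q *\<^sub>v h) \<bullet> d"
    by (simp add: add_scalar_prod_distrib[of _ n] scalar_prod_add_distrib[of _ n])
  \<comment> \<open>Stationarity, tested against the displacement \<open>d\<close>.\<close>
  have "(qp_P Q *\<^sub>v x + transpose_mat (qp_A Q) *\<^sub>v lam) \<bullet> d = (- s) \<bullet> d"
    using K by (simp add: s_def)
  then have "(qp_P Q *\<^sub>v x) \<bullet> d + (transpose_mat (qp_A Q) *\<^sub>v lam) \<bullet> d = - (s \<bullet> d)"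
    by (simp add: add_scalar_prod_distrib[of _ n] uminus_scalar_prod[of _ n] del: scalar_prod_uminus_left)
  moreover have "(transpose_mat (qp_A Q) *\<^sub>v lam) \<bullet> d = lam \<bullet> (qp_A Q *\<^sub>v d)"
    by (rule transpose_vec_mult_scalar[OF D(5)]) auto
  moreover have "(transpose_mat (qp_N Q) *\<^sub>v x) \<bullet> h = x \<bullet> (qp_N Q *\<^sub>v h)"
    by (rule transpose_vec_mult_scalar[OF D(4)]) auto
  moreover have "x \<bullet> (qp_N Q *\<^sub>v h) = (qp_N Q *\<^sub>v h) \<bullet> x"
    by (rule comm_scalar_prod[of _ n]) auto
  ultimately show ?thesis
    unfolding qp_objective_def shift quad lin by (simp add: s_def[symmetric] add_divide_distrib)
qed

text \<open>For a feasible \<open>y\<close>, the expansion with \<open>h = 0\<close> and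
  \<open>d = y - x\<close> keeps only the quadratic term, which is nonnegative. The infimum is
  therefore attained at \<open>x\<close>, hence finite, and \<open>real_of_ereal\<close> returns it
  unchanged.\<close>

lemma value_function_eq:
  assumes Q: "is_open_qp m n p Q" and psd: "pos_semidef n (qp_P Q)"
    and u: "u \<in> carrier_vec m" and sol: "is_kkt_solution Q u (x, lam)"
  shows "value_function Q u = qp_objective Q u x"
proof -
  note D = is_open_qpD[OF Q]
  note K = sol[unfolded is_kkt_solution_iff[OF Q u]]
  have x: "x \<in> carrier_vec n" and lam: "lam \<in> carrier_vec p" using K by auto
  have Mu: "qp_M Q *\<^sub>v u \<in> carrier_vec p" using D u by auto
  have feas: "x \<in> qp_feasible Q u"
    using K D Mu by (auto simp: qp_feasible_def)
  have le: "qp_objective Q u x \<le> qp_objective Q u y" if y: "y \<in> qp_feasible Q u" for y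
  proof -
    have yc: "y \<in> carrier_vec n" and Ay: "qp_A Q *\<^sub>v y + qp_M Q *\<^sub>v u = qp_b Q"
      using y D by (auto simp: qp_feasible_def)
    have "qp_A Q *\<^sub>v y \<in> carrier_vec p" using D yc by auto
    then have "qp_A Q *\<^sub>v y = qp_b Q - qp_M Q *\<^sub>v u"
      using Mu unfolding Ay[symmetric] by (intro eq_vecI) (use D in \<open>auto\<close>)
    then have "qp_A Q *\<^sub>v (y - x) = (qp_b Q - qp_M Q *\<^sub>v u) - (qp_b Q - qp_M Q *\<^sub>v u)"
      using K by (simp add: mult_minus_distrib_mat_vec[OF D(5) yc x])
    also have "\<dots> = 0\<^sub>v p" using D Mu by auto
    finally have A0: "qp_A Q *\<^sub>v (y - x) = 0\<^sub>v p" .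
    have dc: "y - x \<in> carrier_vec n" using x yc by simp
    have N0: "qp_N Q *\<^sub>v 0\<^sub>v m = 0\<^sub>v n" using D by (intro eq_vecI) auto
    have "x + (y - x) = y" using x yc by auto
    moreover have "u + 0\<^sub>v m = u" using u by simp
    moreover have "(transpose_mat (qp_N Q) *\<^sub>v x) \<bullet> 0\<^sub>v m = 0"
      using D x by (intro scalar_prod_right_zero) auto
    ultimately have "qp_objective Q u y
        = qp_objective Q u x + 1/2 * ((y - x) \<bullet> (qp_P Q *\<^sub>v (y - x)))"
      using qp_objective_perturb[OF Q sol u zero_carrier_vec dc] lam dc by (simp add: A0 N0)
    moreover have "0 \<le> (y - x) \<bullet> (qp_P Q *\<^sub>v (y - x))"
      using psd dc by (simp add: pos_semidef_def)
    ultimately show ?thesis by simp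
  qed
  have "program_value (qp_objective Q u) (qp_feasible Q u) = ereal (qp_objective Q u x)"
    unfolding program_value_def using feas le by (intro antisym INF_lower INF_greatest) auto
  then show ?thesis by (simp add: value_function_def)
qed

section \<open>Quadratic estimates for the remainder\<close>

lemma abs_mult_mat_vec_index_le:
  fixes B :: rmat
  assumes B: "B \<in> carrier_mat r c" and v: "v \<in> carrier_vec c" and i: "i < r"
  shows "\<bar>(B *\<^sub>v v) $ i\<bar> \<le> (\<Sum>i<r. \<Sum>j<c. \<bar>B $$ (i, j)\<bar>) * euclid_norm v"
proof -
  have "\<bar>(B *\<^sub>v v) $ i\<bar> = \<bar>\<Sum>j<c. B $$ (i, j) * v $ j\<bar>"
    using B v i by (simp add: scalar_prod_def atLeast0LessThan)
  also have "\<dots> \<le> (\<Sum>j<c. \<bar>B $$ (i, j) * v $ j\<bar>)" by (rule sum_abs)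
  also have "\<dots> \<le> (\<Sum>j<c. \<bar>B $$ (i, j)\<bar> * euclid_norm v)"
    using v by (intro sum_mono) (auto simp: abs_mult intro!: mult_left_mono abs_index_le_euclid_norm)
  also have "\<dots> = (\<Sum>j<c. \<bar>B $$ (i, j)\<bar>) * euclid_norm v" by (simp add: sum_distrib_right)
  \<comment> \<open>Enlarging the row sum to the sum over all entries gives one constant valid for
    every row, a crude substitute for an operator norm.\<close>
  also have "\<dots> \<le> (\<Sum>i<r. \<Sum>j<c. \<bar>B $$ (i, j)\<bar>) * euclid_norm v"
    using i member_le_sum[of i "{..<r}" "\<lambda>i. \<Sum>j<c. \<bar>B $$ (i, j)\<bar>"]
    by (intro mult_right_mono euclid_norm_nonneg) (auto simp: sum_nonneg)
  finally show ?thesis .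
qed

lemma abs_scalar_prod_le:
  fixes v w :: rvec
  assumes w: "w \<in> carrier_vec n"
    and bounds: "\<And>i. i < n \<Longrightarrow> \<bar>v $ i\<bar> \<le> a" "\<And>i. i < n \<Longrightarrow> \<bar>w $ i\<bar> \<le> b"
    and a: "0 \<le> a"
  shows "\<bar>v \<bullet> w\<bar> \<le> real n * (a * b)"
proof -
  have "\<bar>v \<bullet> w\<bar> \<le> (\<Sum>i<n. \<bar>v $ i * w $ i\<bar>)"
    using w unfolding scalar_prod_def by (simp add: atLeast0LessThan sum_abs)
  also have "\<dots> \<le> (\<Sum>i<n. a * b)"
    using bounds a by (intro sum_mono) (auto simp: abs_mult intro!: mult_mono)
  finally show ?thesis by simp
qed

text \<open>Both factors are linear in \<open>h\<close>, so each contributes one factor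
  \<open>euclid_norm h\<close>. The second-order terms of the value function have exactly this
  shape.\<close>

lemma abs_scalar_prod_mult_mat_vec_le:
  fixes B C :: rmat
  assumes B: "B \<in> carrier_mat r c" and C: "C \<in> carrier_mat r c"
  shows "\<exists>k\<ge>0. \<forall>h\<in>carrier_vec c. \<bar>(B *\<^sub>v h) \<bullet> (C *\<^sub>v h)\<bar> \<le> k * (euclid_norm h * euclid_norm h)"
proof (intro exI conjI ballI)
  let ?s = "\<lambda>B :: rmat. \<Sum>i<r. \<Sum>j<c. \<bar>B $$ (i, j)\<bar>"
  show "0 \<le> real r * (?s B * ?s C)" by (simp add: sum_nonneg)
  fix h :: rvec assume h: "h \<in> carrier_vec c"
  have "\<bar>(B *\<^sub>v h) \<bullet> (C *\<^sub>v h)\<bar> \<le> real r * ((?s B * euclid_norm h) * (?s C * euclid_norm h))"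
    using B C h
    by (intro abs_scalar_prod_le abs_mult_mat_vec_index_le)
       (auto simp: sum_nonneg euclid_norm_nonneg)
  then show "\<bar>(B *\<^sub>v h) \<bullet> (C *\<^sub>v h)\<bar> \<le> real r * (?s B * ?s C) * (euclid_norm h * euclid_norm h)"
    by (simp add: mult_ac)
qed

lemma has_gradientI_quadratic:
  assumes "u \<in> carrier_vec m" "g \<in> carrier_vec m" and k: "0 \<le> k"
    and bound: "\<And>h. h \<in> carrier_vec m \<Longrightarrow>
      \<bar>f (u + h) - f u - g \<bullet> h\<bar> \<le> k * (euclid_norm h * euclid_norm h)"
  shows "has_gradient m f u g"
  unfolding has_gradient_def
proof (intro conjI allI impI)
  fix e :: real assume e: "e > 0"
  show "\<exists>d>0. \<forall>h\<in>carrier_vec m. euclid_norm h < d \<longrightarrow>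
      \<bar>f (u + h) - f u - g \<bullet> h\<bar> \<le> e * euclid_norm h"
  \<comment> \<open>Dividing by \<open>k + 1\<close> instead of \<open>k\<close> also covers
    \<open>k = 0\<close>.\<close>
  proof (intro exI[of _ "e / (k + 1)"] conjI ballI impI)
    show "0 < e / (k + 1)" using e k by simp
    fix h :: rvec assume h: "h \<in> carrier_vec m" "euclid_norm h < e / (k + 1)"
    have "(k + 1) * euclid_norm h < e" using h(2) k by (simp add: field_simps)
    then have "k * euclid_norm h \<le> e" using euclid_norm_nonneg[of h] by (simp add: algebra_simps)
    then have "k * (euclid_norm h * euclid_norm h) \<le> e * euclid_norm h"
      using euclid_norm_nonneg[of h] by (simp add: mult_right_mono mult.assoc[symmetric])
    then show "\<bar>f (u + h) - f u - g \<bullet> h\<bar> \<le> e * euclid_norm h" using bound[OF h(1)] by linarith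
  qed
qed (use assms in auto)

section \<open>Solving the KKT system\<close>

lemma kkt_inverse:
  assumes Q: "is_open_qp m n p Q" and inv: "invertible_mat (kkt_matrix Q)"
  obtains W where "W \<in> carrier_mat (n + p) (n + p)"
    "W * kkt_matrix Q = 1\<^sub>m (n + p)" "kkt_matrix Q * W = 1\<^sub>m (n + p)"
proof -
  have K: "kkt_matrix Q \<in> carrier_mat (n + p) (n + p)"
    using is_open_qpD[OF Q] by (auto simp: kkt_matrix_def)
  obtain W where W: "kkt_matrix Q * W = 1\<^sub>m (n + p)" "W * kkt_matrix Q = 1\<^sub>m (dim_row W)"
    using inv K by (auto simp: invertible_mat_def inverts_mat_def)
  \<comment> \<open>Invertibility provides \<open>W\<close> without its dimensions; counting columns
    in the two product identities recovers them.\<close>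
  have "dim_col W = n + p" using arg_cong[OF W(1), of dim_col] by simp
  moreover have "dim_row W = n + p" using arg_cong[OF W(2), of dim_col] K by simp
  ultimately have "W \<in> carrier_mat (n + p) (n + p)" by auto
  then show thesis using W that by auto
qed

lemma kkt_solution_unique:
  assumes Q: "is_open_qp m n p Q" and inv: "invertible_mat (kkt_matrix Q)"
    and u: "u \<in> carrier_vec m"
    and sol: "is_kkt_solution Q u (x, lam)"
  shows "kkt_solution Q u = (x, lam)"
  unfolding kkt_solution_def
proof (rule the_equality[where P = "is_kkt_solution Q u", OF sol])
  fix z assume z: "is_kkt_solution Q u z"
  obtain x' lam' where z': "z = (x', lam')" by force
  have K: "kkt_matrix Q \<in> carrier_mat (n + p) (n + p)"
    using is_open_qpD[OF Q] by (auto simp: kkt_matrix_def)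
  obtain W where W: "W \<in> carrier_mat (n + p) (n + p)" "W * kkt_matrix Q = 1\<^sub>m (n + p)"
    using kkt_inverse[OF Q inv] by metis
  have c: "x \<in> carrier_vec n" "lam \<in> carrier_vec p" "x' \<in> carrier_vec n" "lam' \<in> carrier_vec p"
    using sol z z' is_kkt_solution_iff[OF Q u] by auto
  have "W *\<^sub>v (kkt_matrix Q *\<^sub>v (x' @\<^sub>v lam')) = W *\<^sub>v (kkt_matrix Q *\<^sub>v (x @\<^sub>v lam))"
    using sol z z' by (simp add: is_kkt_solution_def)
  then have "(W * kkt_matrix Q) *\<^sub>v (x' @\<^sub>v lam') = (W * kkt_matrix Q) *\<^sub>v (x @\<^sub>v lam)"
    using W(1) K c by (metis append_carrier_vec assoc_mult_mat_vec)
  then have "x' @\<^sub>v lam' = x @\<^sub>v lam" using W(2) c by (simp add: append_carrier_vec)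
  then show "z = (x, lam)" using c z' by (simp add: append_vec_eq[of _ n])
qed

text \<open>Cutting the inverse KKT matrix into its first \<open>n\<close> and last \<open>p\<close>
  rows yields the primal part \<open>X\<close> and the multiplier part \<open>Y\<close>. Solutions
  thereby become explicit linear functions of the right-hand side, which gives existence and lets
  displacements be computed.\<close>

lemma kkt_inverse_blocks:
  assumes Q: "is_open_qp m n p Q" and inv: "invertible_mat (kkt_matrix Q)"
  obtains X Y where "X \<in> carrier_mat n (n + p)" "Y \<in> carrier_mat p (n + p)"
    "\<And>a b. a \<in> carrier_vec n \<Longrightarrow> b \<in> carrier_vec p \<Longrightarrow>
      qp_P Q *\<^sub>v (X *\<^sub>v (a @\<^sub>v b)) + transpose_mat (qp_A Q) *\<^sub>v (Y *\<^sub>v (a @\<^sub>v b)) = a \<and>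
      qp_A Q *\<^sub>v (X *\<^sub>v (a @\<^sub>v b)) = b"
proof -
  note D = is_open_qpD[OF Q]
  have K: "kkt_matrix Q \<in> carrier_mat (n + p) (n + p)"
    using D by (auto simp: kkt_matrix_def)
  obtain W where W: "W \<in> carrier_mat (n + p) (n + p)" "kkt_matrix Q * W = 1\<^sub>m (n + p)"
    using kkt_inverse[OF Q inv] by metis
  define X where "X = mat n (n + p) (\<lambda>(i, j). W $$ (i, j))"
  define Y where "Y = mat p (n + p) (\<lambda>(i, j). W $$ (n + i, j))"
  have XY: "X \<in> carrier_mat n (n + p)" "Y \<in> carrier_mat p (n + p)" by (auto simp: X_def Y_def)
  have "qp_P Q *\<^sub>v (X *\<^sub>v (a @\<^sub>v b)) + transpose_mat (qp_A Q) *\<^sub>v (Y *\<^sub>v (a @\<^sub>v b)) = a \<and>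
      qp_A Q *\<^sub>v (X *\<^sub>v (a @\<^sub>v b)) = b"
    if a: "a \<in> carrier_vec n" and b: "b \<in> carrier_vec p" for a b
  proof -
    let ?r = "a @\<^sub>v b" and ?x = "X *\<^sub>v (a @\<^sub>v b)" and ?y = "Y *\<^sub>v (a @\<^sub>v b)"
    have r: "?r \<in> carrier_vec (n + p)" using a b by simp
    have xy: "?x \<in> carrier_vec n" "?y \<in> carrier_vec p"
      by (rule mult_mat_vec_carrier_row, rule XY)+
    have row: "row W i = (if i < n then row X i else row Y (i - n))" if "i < n + p" for i
      using that W(1) by (intro eq_vecI) (auto simp: X_def Y_def)
    have "W *\<^sub>v ?r = ?x @\<^sub>v ?y"
      using W(1) XY row by (intro eq_vecI) auto
    then have "kkt_matrix Q *\<^sub>v (?x @\<^sub>v ?y) = kkt_matrix Q *\<^sub>v (W *\<^sub>v ?r)" by simp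
    also have "\<dots> = a @\<^sub>v b"
      using W r K by (simp add: assoc_mult_mat_vec[OF K W(1) r, symmetric])
    finally have "kkt_matrix Q *\<^sub>v (?x @\<^sub>v ?y) = a @\<^sub>v b" .
    moreover have "kkt_matrix Q *\<^sub>v (?x @\<^sub>v ?y)
        = (qp_P Q *\<^sub>v ?x + transpose_mat (qp_A Q) *\<^sub>v ?y) @\<^sub>v (qp_A Q *\<^sub>v ?x + 0\<^sub>m p p *\<^sub>v ?y)"
      unfolding kkt_matrix_def D(8) using xy D by (intro four_block_mat_mult_vec) auto
    moreover have "0\<^sub>m p p *\<^sub>v ?y = 0\<^sub>v p" using xy by (intro eq_vecI) auto
    moreover have "qp_A Q *\<^sub>v ?x + 0\<^sub>v p = qp_A Q *\<^sub>v ?x" using xy D by simp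
    moreover have "qp_P Q *\<^sub>v ?x + transpose_mat (qp_A Q) *\<^sub>v ?y \<in> carrier_vec n"
      using xy D by auto
    ultimately show ?thesis using a by (simp add: append_vec_eq[of _ n])
  qed
  then show thesis using that XY by blast
qed

text \<open>The KKT point depends affinely on the input, so the optimal values at \<open>u\<close>
  and \<open>u + h\<close> can be compared exactly through \<open>qp_objective_perturb\<close>. What
  remains beyond the linear term is a quadratic form in \<open>h\<close>.\<close>

lemma has_gradient_value_function:
  assumes Q: "is_open_qp m n p Q" and psd: "pos_semidef n (qp_P Q)"
    and inv: "invertible_mat (kkt_matrix Q)" and u: "u \<in> carrier_vec m"
  shows "has_gradient m (value_function Q) u
    (transpose_mat (qp_N Q) *\<^sub>v fst (kkt_solution Q u)
      + transpose_mat (qp_M Q) *\<^sub>v snd (kkt_solution Q u))"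
proof -
  note D = is_open_qpD[OF Q]
  obtain X Y where XY: "X \<in> carrier_mat n (n + p)" "Y \<in> carrier_mat p (n + p)"
    and solve: "\<And>a b. a \<in> carrier_vec n \<Longrightarrow> b \<in> carrier_vec p \<Longrightarrow>
      qp_P Q *\<^sub>v (X *\<^sub>v (a @\<^sub>v b)) + transpose_mat (qp_A Q) *\<^sub>v (Y *\<^sub>v (a @\<^sub>v b)) = a \<and>
      qp_A Q *\<^sub>v (X *\<^sub>v (a @\<^sub>v b)) = b"
    using kkt_inverse_blocks[OF Q inv] by metis
  note [simp] = D(1,3-7) XY u
  define r where "r = (- (qp_q Q + qp_N Q *\<^sub>v u)) @\<^sub>v (qp_b Q - qp_M Q *\<^sub>v u)"
  define x where "x = X *\<^sub>v r"
  define lam where "lam = Y *\<^sub>v r"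
  have x[simp]: "x \<in> carrier_vec n" and lam[simp]: "lam \<in> carrier_vec p"
    unfolding x_def lam_def by (rule mult_mat_vec_carrier_row, rule XY)+
  have Nu: "qp_N Q *\<^sub>v v \<in> carrier_vec n" "qp_M Q *\<^sub>v v \<in> carrier_vec p" for v
    by (rule mult_mat_vec_carrier_row, rule D)+
  have sol: "is_kkt_solution Q u (x, lam)"
    using solve[of "- (qp_q Q + qp_N Q *\<^sub>v u)" "qp_b Q - qp_M Q *\<^sub>v u"] Nu
    by (simp add: is_kkt_solution_iff[OF Q u] x_def[symmetric] lam_def[symmetric] r_def[symmetric])
  \<comment> \<open>\<open>J\<close> is the derivative of the KKT right-hand side with respect to
    the input. Hence \<open>B h\<close> and \<open>C h\<close> are the displacements of the primal
    solution and of the multiplier.\<close>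
  define J where "J = (- qp_N Q) @\<^sub>r (- qp_M Q)"
  have J: "J \<in> carrier_mat (n + p) m" by (simp add: J_def)
  define B where "B = X * J"
  define C where "C = Y * J"
  have B: "B \<in> carrier_mat n m" and C: "C \<in> carrier_mat p m" unfolding B_def C_def by (rule mult_carrier_mat[OF _ J], simp)+
  have PB: "qp_P Q * B \<in> carrier_mat n m" using D(1) B by (rule mult_carrier_mat)
  \<comment> \<open>\<open>k1\<close> and \<open>k2\<close> bound the terms
    \<open>(N h) \<bullet> d\<close> and \<open>d \<bullet> (P d)\<close> with
    \<open>d = B h\<close>; the second enters the objective with factor 1/2, whence
    \<open>k1 + k2 / 2\<close> below.\<close>
  obtain k1 where k1: "k1 \<ge> 0" "\<And>h. h \<in> carrier_vec m \<Longrightarrow>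
      \<bar>(qp_N Q *\<^sub>v h) \<bullet> (B *\<^sub>v h)\<bar> \<le> k1 * (euclid_norm h * euclid_norm h)"
    using abs_scalar_prod_mult_mat_vec_le[OF D(4) B] by blast
  obtain k2 where k2: "k2 \<ge> 0" "\<And>h. h \<in> carrier_vec m \<Longrightarrow>
      \<bar>(B *\<^sub>v h) \<bullet> ((qp_P Q * B) *\<^sub>v h)\<bar> \<le> k2 * (euclid_norm h * euclid_norm h)"
    using abs_scalar_prod_mult_mat_vec_le[OF B PB] by blast
  let ?g = "transpose_mat (qp_N Q) *\<^sub>v x + transpose_mat (qp_M Q) *\<^sub>v lam"
  have g: "transpose_mat (qp_N Q) *\<^sub>v x \<in> carrier_vec m" "transpose_mat (qp_M Q) *\<^sub>v lam \<in> carrier_vec m"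
    using D(4,6)[THEN mult_transpose_mat_vec_carrier] by blast+
  have "has_gradient m (value_function Q) u ?g"
  proof (rule has_gradientI_quadratic[where k = "k1 + k2 / 2"])
    show "?g \<in> carrier_vec m" using g by simp
    show "0 \<le> k1 + k2 / 2" using k1 k2 by simp
    fix h :: rvec assume h[simp]: "h \<in> carrier_vec m"
    define d where "d = B *\<^sub>v h"
    define l where "l = C *\<^sub>v h"
    have d[simp]: "d \<in> carrier_vec n" and l[simp]: "l \<in> carrier_vec p"
      using B C by (auto simp: d_def l_def)
    have Jh: "J *\<^sub>v h = (- (qp_N Q *\<^sub>v h)) @\<^sub>v (- (qp_M Q *\<^sub>v h))"
    proof -
      have "- qp_N Q *\<^sub>v h = - (qp_N Q *\<^sub>v h)"
        by (rule uminus_mult_mat_vec) (metis D(4) h carrier_matD(2) carrier_vecD)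
      moreover have "- qp_M Q *\<^sub>v h = - (qp_M Q *\<^sub>v h)"
        by (rule uminus_mult_mat_vec) (metis D(6) h carrier_matD(2) carrier_vecD)
      moreover have "J *\<^sub>v h = (- qp_N Q *\<^sub>v h) @\<^sub>v (- qp_M Q *\<^sub>v h)"
        unfolding J_def by (rule mat_mult_append[of _ n m _ p]) auto
      ultimately show ?thesis by simp
    qed
    have dl: "d = X *\<^sub>v (J *\<^sub>v h)" "l = Y *\<^sub>v (J *\<^sub>v h)"
      unfolding d_def l_def B_def C_def
      by (rule assoc_mult_mat_vec[OF XY(1) J h], rule assoc_mult_mat_vec[OF XY(2) J h])
    have s: "qp_P Q *\<^sub>v d + transpose_mat (qp_A Q) *\<^sub>v l = - (qp_N Q *\<^sub>v h)"
      "qp_A Q *\<^sub>v d = - (qp_M Q *\<^sub>v h)"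
      using solve[of "- (qp_N Q *\<^sub>v h)" "- (qp_M Q *\<^sub>v h)"] Nu unfolding dl Jh by auto
    note K = sol[unfolded is_kkt_solution_iff[OF Q u]]
    have uh: "u + h \<in> carrier_vec m" by simp
    have PA: "qp_P Q *\<^sub>v v \<in> carrier_vec n" "transpose_mat (qp_A Q) *\<^sub>v v \<in> carrier_vec n"
      "qp_A Q *\<^sub>v v \<in> carrier_vec p" for v
      using D(1,5)[THEN mult_mat_vec_carrier_row] D(5)[THEN mult_transpose_mat_vec_carrier] by blast+
    \<comment> \<open>By linearity, the KKT equations at \<open>u\<close> and the equations
      \<open>s\<close> for the displacement add up to the KKT equations at
      \<open>u + h\<close>.\<close>
    have "qp_P Q *\<^sub>v (x + d) + transpose_mat (qp_A Q) *\<^sub>v (lam + l)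
        = (qp_P Q *\<^sub>v x + transpose_mat (qp_A Q) *\<^sub>v lam)
          + (qp_P Q *\<^sub>v d + transpose_mat (qp_A Q) *\<^sub>v l)"
      using PA[of x] PA[of d] PA[of lam] PA[of l]
      by (simp add: mult_add_distrib_mat_vec[OF D(1)]
          mult_add_distrib_mat_vec[of "transpose_mat (qp_A Q)" n p]) (auto intro!: eq_vecI)
    also have "\<dots> = - (qp_q Q + qp_N Q *\<^sub>v (u + h))"
      using K s Nu[of u] Nu[of h] D(3)
      by (simp add: mult_add_distrib_mat_vec[OF D(4)]) (auto intro!: eq_vecI)
    finally have 1: "qp_P Q *\<^sub>v (x + d) + transpose_mat (qp_A Q) *\<^sub>v (lam + l)
      = - (qp_q Q + qp_N Q *\<^sub>v (u + h))" .
    have 2: "qp_A Q *\<^sub>v (x + d) = qp_b Q - qp_M Q *\<^sub>v (u + h)"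
      using K s Nu[of u] Nu[of h] D(7)
      by (simp add: mult_add_distrib_mat_vec[OF D(5)] mult_add_distrib_mat_vec[OF D(6)])
         (auto intro!: eq_vecI)
    have "is_kkt_solution Q (u + h) (x + d, lam + l)"
      using 1 2 by (simp add: is_kkt_solution_iff[OF Q uh])
    then have "value_function Q (u + h) = qp_objective Q (u + h) (x + d)"
      by (rule value_function_eq[OF Q psd uh])
    moreover have "value_function Q u = qp_objective Q u x"
      by (rule value_function_eq[OF Q psd u sol])
    moreover have "?g \<bullet> h = (transpose_mat (qp_N Q) *\<^sub>v x) \<bullet> h + (transpose_mat (qp_M Q) *\<^sub>v lam) \<bullet> h"
      using g by (intro add_scalar_prod_distrib[of _ m]) auto
    moreover have "(transpose_mat (qp_M Q) *\<^sub>v lam) \<bullet> h = lam \<bullet> (qp_M Q *\<^sub>v h)"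
      by (rule transpose_vec_mult_scalar[OF D(6)]) auto
    \<comment> \<open>Feasibility of the displaced point, \<open>A d = - M h\<close>, converts the
      multiplier term into the contribution of \<open>M^T lam\<close> to the gradient.\<close>
    moreover have "lam \<bullet> (qp_A Q *\<^sub>v d) = - (lam \<bullet> (qp_M Q *\<^sub>v h))"
      unfolding s(2) by (rule scalar_prod_uminus_right) (metis lam Nu(2) carrier_vecD)
    moreover have "qp_P Q *\<^sub>v d = (qp_P Q * B) *\<^sub>v h"
      unfolding d_def by (rule assoc_mult_mat_vec[OF D(1) B h, symmetric])
    ultimately have "value_function Q (u + h) - value_function Q u - ?g \<bullet> h
        = (qp_N Q *\<^sub>v h) \<bullet> (B *\<^sub>v h) + 1/2 * ((B *\<^sub>v h) \<bullet> ((qp_P Q * B) *\<^sub>v h))"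
      using qp_objective_perturb[OF Q sol u h d] by (simp add: d_def)
    then show "\<bar>value_function Q (u + h) - value_function Q u - ?g \<bullet> h\<bar>
        \<le> (k1 + k2 / 2) * (euclid_norm h * euclid_norm h)"
      using k1(2)[OF h] k2(2)[OF h] by (simp add: distrib_right)
  qed simp
  \<comment> \<open>Uniqueness identifies the explicitly constructed pair with
    \<open>kkt_solution Q u\<close>.\<close>
  then show ?thesis by (simp add: kkt_solution_unique[OF Q inv u sol])
qed

text \<open>A gradient exists at every input and is unique, so \<open>has_gradient\<close> is the
  graph of the formula that defines the primal-dual behavior.\<close>

lemma gradient_graph_value_function:
  assumes Q: "is_open_qp m n p Q" "pos_semidef n (qp_P Q)" "invertible_mat (kkt_matrix Q)"
  shows "gradient_graph m (value_function Q) = pd_behavior m Q"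
proof -
  have "has_gradient m (value_function Q) u y \<longleftrightarrow> u \<in> carrier_vec m \<and>
     y = transpose_mat (qp_N Q) *\<^sub>v fst (kkt_solution Q u)
       + transpose_mat (qp_M Q) *\<^sub>v snd (kkt_solution Q u)" for u y
    using has_gradient_value_function[OF Q] has_gradient_unique
    by (metis has_gradient_def)
  then show ?thesis by (simp add: gradient_graph_def pd_behavior_def)
qed

section \<open>Constants in the objective\<close>

lemma add_const_simps [simp]:
  "qp_P (add_const \<kappa> Q) = qp_P Q" "qp_q (add_const \<kappa> Q) = qp_q Q"
  "qp_N (add_const \<kappa> Q) = qp_N Q" "qp_A (add_const \<kappa> Q) = qp_A Q"
  "qp_M (add_const \<kappa> Q) = qp_M Q" "qp_b (add_const \<kappa> Q) = qp_b Q"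
  "kkt_matrix (add_const \<kappa> Q) = kkt_matrix Q"
  "is_open_qp m n p (add_const \<kappa> Q) \<longleftrightarrow> is_open_qp m n p Q"
  "qp_objective (add_const \<kappa> Q) u x = qp_objective Q u x + \<kappa>"
  by (simp_all add: add_const_def kkt_matrix_def is_open_qp_def qp_objective_def)

lemma pd_behavior_add_const: "pd_behavior m (add_const \<kappa> Q) = pd_behavior m Q"
  by (simp add: pd_behavior_def kkt_solution_def is_kkt_solution_def)

lemma program_value_add_const_le:
  "program_value f S + ereal \<kappa> \<le> program_value (\<lambda>x. f x + \<kappa>) S"
  unfolding program_value_def plus_ereal.simps(1)[symmetric]
  by (intro INF_greatest add_right_mono INF_lower)

text \<open>The reverse inequality is the preceding one for the shifted objective and the constant
  \<open>- \<kappa>\<close>. In the extended reals the identity also covers empty and unbounded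
  programs, since infinite values absorb \<open>\<kappa>\<close>.\<close>

lemma program_value_add_const:
  "program_value (\<lambda>x. f x + \<kappa>) S = program_value f S + ereal \<kappa>"
proof (rule antisym)
  have "program_value (\<lambda>x. f x + \<kappa>) S + ereal (- \<kappa>) \<le> program_value f S"
    using program_value_add_const_le[of "\<lambda>x. f x + \<kappa>" S "- \<kappa>"] by simp
  then have "program_value (\<lambda>x. f x + \<kappa>) S + ereal (- \<kappa>) + ereal \<kappa> \<le> program_value f S + ereal \<kappa>"
    by (rule add_right_mono)
  then show "program_value (\<lambda>x. f x + \<kappa>) S \<le> program_value f S + ereal \<kappa>"
    by (simp add: add.assoc)
qed (rule program_value_add_const_le)

subsection \<open>Determinants of positive definite matrices\<close>

text \<open>The determinant of \<open>H\<close> is the value at 0 of the characteristic polynomial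
  of \<open>- H\<close>, which is monic. Were it nonpositive, there would be a root
  \<open>t \<ge> 0\<close>, and an eigenvector for it would satisfy
  \<open>v \<bullet> (H v) = - t (v \<bullet> v) \<le> 0\<close>.\<close>

lemma pos_def_det_pos:
  assumes "pos_def n H"
  shows "0 < Determinant.det H"
proof (rule ccontr)
  assume neg: "\<not> 0 < Determinant.det H"
  have H: "H \<in> carrier_mat n n" using assms by (simp add: pos_def_def)
  define f where "f = char_poly (- H)"
  have "poly f 0 = Determinant.det (- char_matrix (- H) 0)"
    unfolding f_def using H by (intro char_poly_matrix) auto
  also have "- char_matrix (- H) 0 = H" using H by (intro eq_matI) (auto simp: char_matrix_def)
  finally have f0: "poly f 0 \<le> 0" using neg by simp
  have "lead_coeff f = 1"
    using degree_monic_char_poly[of "- H" n] H by (simp add: f_def)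
  then obtain b where b: "\<And>x. b \<le> x \<Longrightarrow> lead_coeff f \<le> poly f x"
    using poly_pinfty_gt_lc[of f] by auto
  \<comment> \<open>The maximum with 0 makes \<open>c\<close> a legitimate right end for the
    intermediate value theorem on the interval from 0 to \<open>c\<close>.\<close>
  define c where "c = max b 0"
  have c: "0 \<le> c" "b \<le> c" by (auto simp: c_def)
  then have "0 < poly f c" using \<open>lead_coeff f = 1\<close> b[of c] by linarith
  then obtain t where t: "0 \<le> t" "poly f t = 0"
    using f0 c IVT'[of "poly f" 0 0 c] continuous_on_poly[OF continuous_on_id] by auto
  then have "eigenvalue (- H) t"
    using eigenvalue_root_char_poly[of "- H" n t] H by (simp add: f_def)
  then obtain v where v: "v \<in> carrier_vec n" "v \<noteq> 0\<^sub>v n" "- H *\<^sub>v v = t \<cdot>\<^sub>v v"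
    using H by (auto simp: eigenvalue_def eigenvector_def)
  have "0 < v \<bullet> (H *\<^sub>v v)" using assms v by (simp add: pos_def_def)
  moreover have "v \<bullet> (- H *\<^sub>v v) = - (v \<bullet> (H *\<^sub>v v))"
    using H v(1) by (simp add: uminus_mult_mat_vec)
  moreover have "v \<bullet> (- H *\<^sub>v v) = t * (v \<bullet> v)" using v by simp
  ultimately show False using t(1) scalar_prod_self_nonneg[of v] by (smt (verit) mult_nonneg_nonneg)
qed

text \<open>Padding \<open>v\<close> with zeros embeds the quadratic form of \<open>A\<close> into
  that of the block matrix.\<close>

lemma pos_def_upper_left:
  assumes pd: "pos_def (n + m) (four_block_mat A B (transpose_mat B) C)"
    and A: "A \<in> carrier_mat n n" and B: "B \<in> carrier_mat n m" and C: "C \<in> carrier_mat m m"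
  shows "pos_def n A"
  unfolding pos_def_def
proof (intro conjI ballI impI)
  let ?H = "four_block_mat A B (transpose_mat B) C"
  have Ht: "transpose_mat ?H = ?H" using pd by (simp add: pos_def_def)
  show "transpose_mat A = A"
  proof (rule eq_matI)
    fix i j assume ij: "i < dim_row A" "j < dim_col A"
    have "transpose_mat ?H $$ (i, j) = ?H $$ (i, j)" by (simp add: Ht)
    then show "transpose_mat A $$ (i, j) = A $$ (i, j)" using ij A B C by simp
  qed (use A in auto)
  fix v :: rvec assume v: "v \<in> carrier_vec n" "v \<noteq> 0\<^sub>v n"
  let ?w = "v @\<^sub>v 0\<^sub>v m"
  have "?w \<noteq> 0\<^sub>v (n + m)"
  proof
    assume "?w = 0\<^sub>v (n + m)"
    also have "0\<^sub>v (n + m) = 0\<^sub>v n @\<^sub>v (0\<^sub>v m :: rvec)" by (intro eq_vecI) auto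
    finally show False using v by (simp add: append_vec_eq[of _ n])
  qed
  then have "0 < ?w \<bullet> (?H *\<^sub>v ?w)" using pd v(1) by (simp add: pos_def_def)
  also have "?H *\<^sub>v ?w = (A *\<^sub>v v + B *\<^sub>v 0\<^sub>v m) @\<^sub>v (transpose_mat B *\<^sub>v v + C *\<^sub>v 0\<^sub>v m)"
    using A B C v by (intro four_block_mat_mult_vec) auto
  also have "?w \<bullet> \<dots> = v \<bullet> (A *\<^sub>v v + B *\<^sub>v 0\<^sub>v m) + 0\<^sub>v m \<bullet> (transpose_mat B *\<^sub>v v + C *\<^sub>v 0\<^sub>v m)"
    using A B C v by (intro scalar_prod_append[of _ n _ m]) (auto intro!: add_carrier_vec)
  also have "0\<^sub>v m \<bullet> (transpose_mat B *\<^sub>v v + C *\<^sub>v 0\<^sub>v m) = 0"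
    using A B C v by (intro scalar_prod_left_zero) (auto intro!: add_carrier_vec)
  also have "B *\<^sub>v 0\<^sub>v m = 0\<^sub>v n" using B by (intro eq_vecI) auto
  finally show "0 < v \<bullet> (A *\<^sub>v v)" using A v by simp
qed (use A in auto)

text \<open>A nonzero determinant makes \<open>H\<close> a unit of the matrix ring. This excludes
  the result \<open>None\<close>, so \<open>the\<close> is applied to a genuine inverse.\<close>

lemma inv_mat_inverse:
  assumes H: "H \<in> carrier_mat n n" and det: "Determinant.det H \<noteq> 0"
  shows "inv_mat H \<in> carrier_mat n n" "H * inv_mat H = 1\<^sub>m n" "inv_mat H * H = 1\<^sub>m n"
proof -
  have "H \<in> Units (ring_mat TYPE(real) n ())"
    using det_non_zero_imp_unit[OF H det] .
  then have "mat_inverse H \<noteq> None"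
    using mat_inverse(1)[OF H, where b = "()"] by blast
  then obtain B where "mat_inverse H = Some B" by blast
  then show "inv_mat H \<in> carrier_mat n n" "H * inv_mat H = 1\<^sub>m n" "inv_mat H * H = 1\<^sub>m n"
    using mat_inverse(2)[OF H] by (auto simp: inv_mat_def)
qed

text \<open>Block LU factorization: with \<open>E = C A^-1\<close>, the matrix is a unit lower
  triangular block matrix times the upper triangular one with diagonal blocks \<open>A\<close> and
  \<open>S\<close>. The first factor has determinant 1.\<close>

lemma det_schur_complement:
  assumes A: "A \<in> carrier_mat n n" and B: "B \<in> carrier_mat n m"
    and C: "C \<in> carrier_mat m n" and D: "D \<in> carrier_mat m m"
    and det: "Determinant.det A \<noteq> 0"
  shows "Determinant.det (four_block_mat A B C D)
    = Determinant.det A * Determinant.det (D - C * inv_mat A * B)"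
proof -
  note I = inv_mat_inverse[OF A det]
  define E where "E = C * inv_mat A"
  define S where "S = D - E * B"
  let ?U = "four_block_mat (1\<^sub>m n) (0\<^sub>m n m) E (1\<^sub>m m)"
  let ?V = "four_block_mat A B (0\<^sub>m m n) S"
  have E: "E \<in> carrier_mat m n" unfolding E_def using C I(1) by (rule mult_carrier_mat)
  have EB: "E * B \<in> carrier_mat m m" using E B by (rule mult_carrier_mat)
  have S: "S \<in> carrier_mat m m" unfolding S_def using EB by (rule minus_carrier_mat)
  have EA: "E * A = C"
    unfolding E_def assoc_mult_mat[OF C I(1) A] I(3) using C by (rule right_mult_one_mat)
  have "X + (D - X) = D" if "X \<in> carrier_mat m m" for X
    using that D by (intro eq_matI) auto
  then have EBS: "E * B + S = D" unfolding S_def using EB .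
  have "?U * ?V = four_block_mat (1\<^sub>m n * A + 0\<^sub>m n m * 0\<^sub>m m n) (1\<^sub>m n * B + 0\<^sub>m n m * S)
      (E * A + 1\<^sub>m m * 0\<^sub>m m n) (E * B + 1\<^sub>m m * S)"
    by (rule mult_four_block_mat[OF one_carrier_mat zero_carrier_mat E one_carrier_mat
          A B zero_carrier_mat S])
  also have "\<dots> = four_block_mat A B C D"
    using A B C S EA EBS by simp
  finally have "Determinant.det (four_block_mat A B C D) = Determinant.det (?U * ?V)" by simp
  also have "\<dots> = Determinant.det ?U * Determinant.det ?V"
    using A S by (intro det_mult[of _ "n + m"]) auto
  also have "Determinant.det ?U = Determinant.det (1\<^sub>m n) * Determinant.det (1\<^sub>m m)"
    by (rule det_four_block_mat_upper_right_zero[OF one_carrier_mat refl E one_carrier_mat])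
  also have "Determinant.det ?V = Determinant.det A * Determinant.det S"
    by (rule det_four_block_mat_lower_left_zero[OF A B refl S])
  finally show ?thesis by (simp add: S_def E_def)
qed

text \<open>The determinants of the whole matrix and of \<open>A\<close> are positive by
  definiteness; that of \<open>S\<close> is positive as their quotient. The signs are part of the
  conclusion so that every \<open>ln\<close> is a logarithm of a positive number.\<close>

lemma pos_def_ln_det_schur_complement:
  assumes pd: "pos_def (n + m) (four_block_mat A B (transpose_mat B) C)"
    and A: "A \<in> carrier_mat n n" and B: "B \<in> carrier_mat n m" and C: "C \<in> carrier_mat m m"
  defines "S \<equiv> C - transpose_mat B * inv_mat A * B"
  shows "0 < Determinant.det (four_block_mat A B (transpose_mat B) C)"
    "0 < Determinant.det A" "0 < Determinant.det S"
    "ln (Determinant.det (four_block_mat A B (transpose_mat B) C))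
      = ln (Determinant.det A) + ln (Determinant.det S)"
proof -
  show 1: "0 < Determinant.det (four_block_mat A B (transpose_mat B) C)"
    by (rule pos_def_det_pos[OF pd])
  show 2: "0 < Determinant.det A"
    by (rule pos_def_det_pos[OF pos_def_upper_left[OF pd A B C]])
  have eq: "Determinant.det (four_block_mat A B (transpose_mat B) C)
      = Determinant.det A * Determinant.det S"
    unfolding S_def using A B C 2 by (intro det_schur_complement) auto
  then show 3: "0 < Determinant.det S" using 1 2 by (simp add: zero_less_mult_iff)
  show "ln (Determinant.det (four_block_mat A B (transpose_mat B) C))
      = ln (Determinant.det A) + ln (Determinant.det S)"
    unfolding eq using 2 3 by (simp add: ln_mult)
qed

subsection \<open>Free energies\<close>

text \<open>The sum on the left counts the expectation of \<open>ln \<mu>\<close> twice, the joint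
  free energy only once. The surplus copy is the negative entropy.\<close>

lemma free_energy_add:
  fixes \<mu> \<psi>1 \<psi>2 :: "real^'l \<Rightarrow> real"
  assumes meas: "\<mu> \<in> borel_measurable lebesgue" "\<psi>1 \<in> borel_measurable lebesgue"
      "\<psi>2 \<in> borel_measurable lebesgue"
    and pos: "\<And>z. 0 < \<psi>1 z" "\<And>z. 0 < \<psi>2 z"
    and int: "integrable (belief_measure \<mu>)
      (\<lambda>z. \<bar>ln (\<mu> z)\<bar> + \<bar>ln (\<psi>1 z)\<bar> + \<bar>ln (\<psi>2 z)\<bar>)"
  shows "free_energy \<mu> \<psi>1 + free_energy \<mu> \<psi>2
    = free_energy \<mu> (\<lambda>z. \<psi>1 z * \<psi>2 z) - differential_entropy \<mu>"
proof -
  let ?M = "belief_measure \<mu>"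
  have sets[measurable_cong]: "sets ?M = sets lebesgue" by (simp add: belief_measure_def)
  note [measurable] = meas
  have i: "integrable ?M (\<lambda>z. ln (\<mu> z))" "integrable ?M (\<lambda>z. ln (\<psi>1 z))"
    "integrable ?M (\<lambda>z. ln (\<psi>2 z))"
    \<comment> \<open>Each logarithm is dominated by the integrable sum of absolute values, so the
      expectations may be split termwise.\<close>
    by (rule Bochner_Integration.integrable_bound[OF int]; simp)+
  have "free_energy \<mu> (\<lambda>z. \<psi>1 z * \<psi>2 z)
      = belief_expectation \<mu> (\<lambda>z. ln (\<mu> z) - (ln (\<psi>1 z) + ln (\<psi>2 z)))"
    unfolding free_energy_def by (simp add: ln_mult pos pos[THEN less_imp_neq, symmetric])
  then show ?thesis
    using i by (simp add: free_energy_def differential_entropy_def belief_expectation_def)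
qed

section \<open>The four statements combined\<close>

theorem theorem9:
  fixes m n1 n2 p1 p2 d1 d2 :: nat
    and Q1 Q2 :: open_qp
    and Z1 Z2 G P1h P2h Lh P12h :: rmat
    and \<psi>1 \<psi>2 \<mu> :: "real^'l \<Rightarrow> real"
    and Z12 :: ennreal
  assumes qp1: "is_open_qp m n1 p1 Q1" "qp_const Q1 = 0"
    and qp2: "is_open_qp m n2 p2 Q2" "qp_const Q2 = 0"
    and psd: "pos_semidef n1 (qp_P Q1)" "pos_semidef n2 (qp_P Q2)"
    and kkt: "invertible_mat (kkt_matrix Q1)" "invertible_mat (kkt_matrix Q2)"
    and factors: "\<psi>1 \<in> borel_measurable lebesgue" "\<psi>2 \<in> borel_measurable lebesgue"
      "\<forall>z. 0 < \<psi>1 z" "\<forall>z. 0 < \<psi>2 z"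
    and Z12: "Z12 = (\<integral>\<^sup>+ z. ennreal (\<psi>1 z * \<psi>2 z) \<partial>lebesgue)" "0 < Z12" "Z12 < \<infinity>"
    and belief: "is_density \<mu>"
    and integrable: "integrable (belief_measure \<mu>)
      (\<lambda>z. \<bar>ln (\<mu> z)\<bar> + \<bar>ln (\<psi>1 z)\<bar> + \<bar>ln (\<psi>2 z)\<bar>)"
    and kernels: "orthonormal_kernel_basis n1 d1 (qp_A Q1) Z1"
      "orthonormal_kernel_basis n2 d2 (qp_A Q2) Z2"
    and coupling: "G \<in> carrier_mat n1 n2"
    and P1h: "P1h = transpose_mat Z1 * qp_P Q1 * Z1"
    and P2h: "P2h = transpose_mat Z2 * qp_P Q2 * Z2"
    and Lh: "Lh = transpose_mat Z1 * G * Z2"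
    and P12h: "P12h = four_block_mat P1h Lh (transpose_mat Lh) P2h"
  shows
    "(\<forall>\<kappa>1 \<kappa>2.
        pd_behavior m (add_const \<kappa>1 Q1) = pd_behavior m Q1 \<and>
        pd_behavior m (add_const \<kappa>2 Q2) = pd_behavior m Q2 \<and>
        gradient_graph m (value_function (add_const \<kappa>1 Q1)) = pd_behavior m Q1 \<and>
        gradient_graph m (value_function (add_const \<kappa>2 Q2)) = pd_behavior m Q2 \<and>
        (\<forall>S \<subseteq> (carrier_vec m \<times> carrier_vec n1) \<times> (carrier_vec m \<times> carrier_vec n2).
           program_value (\<lambda>((u1, x1), (u2, x2)).
               qp_objective (add_const \<kappa>1 Q1) u1 x1 + qp_objective (add_const \<kappa>2 Q2) u2 x2) S
           = program_value (\<lambda>((u1, x1), (u2, x2)).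
               qp_objective Q1 u1 x1 + qp_objective Q2 u2 x2) S + ereal (\<kappa>1 + \<kappa>2)))
     \<and>
     (interconnection (value_behavior m (value_function Q1)) (value_behavior m (value_function Q2))
        = value_behavior m (\<lambda>u. value_function Q1 u + value_function Q2 u) \<and>
      interconnection (value_behavior m (value_function Q1)) (value_behavior m (value_function Q2))
        = {(u, gradient m (\<lambda>u. value_function Q1 u + value_function Q2 u) u,
            value_function Q1 u + value_function Q2 u) | u. u \<in> carrier_vec m})
     \<and>
     (pos_def (d1 + d2) P12h \<longrightarrow>
        0 < Determinant.det P12h \<and> 0 < Determinant.det P1h \<and>
        0 < Determinant.det (P2h - transpose_mat Lh * inv_mat P1h * Lh) \<and>
        ln (Determinant.det P12h) =
          ln (Determinant.det P1h)
          + ln (Determinant.det (P2h - transpose_mat Lh * inv_mat P1h * Lh)))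
     \<and>
     free_energy \<mu> \<psi>1 + free_energy \<mu> \<psi>2
       = free_energy \<mu> (\<lambda>z. \<psi>1 z * \<psi>2 z) - differential_entropy \<mu>"
proof (intro conjI allI impI)
  note gr1 = has_gradient_value_function[OF qp1(1) psd(1) kkt(1)]
  note gr2 = has_gradient_value_function[OF qp2(1) psd(2) kkt(2)]
  show "interconnection (value_behavior m (value_function Q1)) (value_behavior m (value_function Q2))
      = value_behavior m (\<lambda>u. value_function Q1 u + value_function Q2 u)"
    by (rule interconnection_value_behavior(1)[OF gr1 gr2])
  then show "interconnection (value_behavior m (value_function Q1)) (value_behavior m (value_function Q2))
      = {(u, gradient m (\<lambda>u. value_function Q1 u + value_function Q2 u) u,
          value_function Q1 u + value_function Q2 u) | u. u \<in> carrier_vec m}"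
    using interconnection_value_behavior(2)[OF gr1 gr2] by (rule trans)
next
  fix \<kappa>1 \<kappa>2 :: real and S :: "((rvec \<times> rvec) \<times> (rvec \<times> rvec)) set"
  let ?f = "\<lambda>((u1, x1), (u2, x2)). qp_objective Q1 u1 x1 + qp_objective Q2 u2 x2"
  \<comment> \<open>The two constants come out of the sum of objectives pointwise, so the shift of
    the value holds over any feasible set \<open>S\<close>.\<close>
  have "(\<lambda>((u1, x1), (u2, x2)).
      qp_objective (add_const \<kappa>1 Q1) u1 x1 + qp_objective (add_const \<kappa>2 Q2) u2 x2)
      = (\<lambda>w. ?f w + (\<kappa>1 + \<kappa>2))"
    by (auto simp: fun_eq_iff)
  then show "program_value (\<lambda>((u1, x1), (u2, x2)).
      qp_objective (add_const \<kappa>1 Q1) u1 x1 + qp_objective (add_const \<kappa>2 Q2) u2 x2) S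
      = program_value ?f S + ereal (\<kappa>1 + \<kappa>2)"
    by (simp only: program_value_add_const)
next
  assume pd: "pos_def (d1 + d2) P12h"
  have Z: "Z1 \<in> carrier_mat n1 d1" "Z2 \<in> carrier_mat n2 d2"
    using kernels by (auto simp: orthonormal_kernel_basis_def)
  have P: "P1h \<in> carrier_mat d1 d1" "Lh \<in> carrier_mat d1 d2" "P2h \<in> carrier_mat d2 d2"
    using Z coupling is_open_qpD(1)[OF qp1(1)] is_open_qpD(1)[OF qp2(1)]
    by (auto simp: P1h P2h Lh)
  note ln_det = pos_def_ln_det_schur_complement[OF pd[unfolded P12h] P]
  show "0 < Determinant.det P12h" unfolding P12h by (rule ln_det(1))
  show "0 < Determinant.det P1h" by (rule ln_det(2))
  show "0 < Determinant.det (P2h - transpose_mat Lh * inv_mat P1h * Lh)" by (rule ln_det(3))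
  show "ln (Determinant.det P12h) = ln (Determinant.det P1h)
      + ln (Determinant.det (P2h - transpose_mat Lh * inv_mat P1h * Lh))"
    unfolding P12h by (rule ln_det(4))
next
  show "free_energy \<mu> \<psi>1 + free_energy \<mu> \<psi>2
      = free_energy \<mu> (\<lambda>z. \<psi>1 z * \<psi>2 z) - differential_entropy \<mu>"
    using belief factors integrable by (intro free_energy_add) (auto simp: is_density_def)
\<comment> \<open>The remaining goals are the invariances. Each shifted program satisfies the same
  hypotheses, so its gradient graph is its own primal-dual behavior, and the KKT system does not see
  the constant.\<close>
qed (use qp1 qp2 psd kkt in \<open>simp_all add: pd_behavior_add_const gradient_graph_value_function\<close>)

end
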